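(* Let $m$ be a positive integer, let $n=2m$ or $n=2m+1$, and let $F(x)=x^{2^{m+1}-1}$ be the power mapping on $\mathbb{F}_{2^n}$. Then: (i) $|\{(a,b)\in\mathbb{F}_{2^n}^2:\mathrm{DDT}_F(a,b)=2^n\}|=1$; (ii) if $n=2m+1$, then $$|\{(a,b)\in\mathbb{F}_{2^n}^2:\mathrm{DDT}_F(a,b)=2\}|=2^{n-1}(2^n-1),$$ $$|\{(a,b)\in\mathbb{F}_{2^n}^2:\mathrm{DDT}_F(a,b)=0\}|=2^{2n-1}+2^{n-1}-1;$$ (iii) if $n=2m$, then $$|\{(a,b)\in\mathbb{F}_{2^n}^2:\mathrm{DDT}_F(a,b)=2^m\}|=2^n-1,$$ $$|\{(a,b)\in\mathbb{F}_{2^n}^2:\mathrm{DDT}_F(a,b)=2\}|=(2^{n-1}-2^{m-1})(2^n-1),$$ $$|\{(a,b)\in\mathbb{F}_{2^n}^2:\mathrm{DDT}_F(a,b)=0\}|=(2^{n-1}+2^{m-1})(2^n-1).$$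
   Context: $\mathbb{F}_{2^n}$ is the finite field with $2^n$ elements. For a mapping $F:\mathbb{F}_{2^n}\to\mathbb{F}_{2^n}$ and $(a,b)\in\mathbb{F}_{2^n}^2$, the Difference Distribution Table (DDT) entry is $$\mathrm{DDT}_F(a,b)=|\{x\in\mathbb{F}_{2^n}: F(x)+F(x+a)=b\}|.$$
   Formalization: In (iii) with m=1, n=2 the values 2^m and 2 coincide and the first two printed counts are false (x^3 on F_4 has 6 such pairs, not 3); there they are replaced by one count of pairs with DDT=2, equal to the sum of the two printed values. *)

theory Defs
  imports "HOL-Library.Cardinality"
begin

definition DDT :: "('a::{field,finite} \<Rightarrow> 'a) \<Rightarrow> 'a \<Rightarrow> 'a \<Rightarrow> nat" where
  "DDT F a b = card {x. F x + F (x + a) = b}"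

end

theory Submission
  imports Defs "HOL-Computational_Algebra.Polynomial"
begin

text \<open>
  Since \<open>DDT F a b = DDT F 1 (b / a ^ d)\<close> for a power map \<open>F x = x ^ d\<close> and \<open>a \<noteq> 0\<close>, only the row
  \<open>a = 1\<close> matters. With \<open>Q = 2 ^ (m + 1)\<close> and \<open>x \<notin> {0, 1}\<close>, clearing denominators turns
  \<open>F x + F (x + 1) = b\<close> into \<open>x ^ Q + x = b * (x ^ 2 + x)\<close>, an additive equation. Raising it to the
  power \<open>Q\<close> and using that \<open>Q ^ 2\<close> is \<open>2\<close> or \<open>4\<close> times the order of the field, one obtains a
  polynomial equation of degree at most 4, whose linear coefficient \<open>(b ^ Q + 1) * (b + 1)\<close> is nonzero
  unless \<open>b = 1\<close>. Two of its at most four roots are 0 and 1, so \<open>DDT F 1 b\<close> is 0 or 2 for \<open>b \<noteq> 1\<close>.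
  For \<open>b = 1\<close> the equation reduces to \<open>x ^ 2 ^ m = x\<close>. As the entries of a row sum up to \<open>2 ^ n\<close>,
  these values determine all counts.
\<close>

section \<open>Finite fields of characteristic 2\<close>

text \<open>Translation by 1 permutes the ring, so adding 1 to every element leaves the sum of all
  elements unchanged.\<close>

lemma of_nat_CARD_eq_0: "of_nat CARD('a) = (0 :: 'a::{ring_1,finite})"
proof -
  have "(\<Sum>x\<in>UNIV. x) = (\<Sum>x\<in>UNIV. x + (1 :: 'a))"
    by (rule sum.reindex_bij_witness[of _ "\<lambda>x. x + 1" "\<lambda>x. x - 1"]) auto
  then show ?thesis
    by (simp add: sum.distrib)
qed

lemma CHAR_eq_2_of_CARD:
  assumes "CARD('a::{field,finite}) = 2 ^ n"
  shows "CHAR('a) = 2"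
proof -
  have dvd: "CHAR('a) dvd 2 ^ n"
    using of_nat_CARD_eq_0[where 'a = 'a] assms of_nat_eq_0_iff_char_dvd by metis
  then have "CHAR('a) > 0"
    by (intro Nat.gr0I) auto
  then have "prime CHAR('a)"
    by (rule prime_CHAR_semidom)
  with dvd show ?thesis
    by (meson prime_dvd_power primes_dvd_imp_eq two_is_prime_nat)
qed

text \<open>Multiplication by a nonzero \<open>x\<close> permutes the nonzero elements; comparing
  their products gives \<open>x ^ (CARD('a) - 1) = 1\<close>.\<close>

lemma power_CARD_eq_same: "x ^ CARD('a) = (x :: 'a::{field,finite})"
proof (cases "x = 0")
  case False
  have "(\<Prod>y\<in>UNIV - {0}. y) = (\<Prod>y\<in>UNIV - {0}. x * y)"
    by (rule prod.reindex_bij_witness[of _ "\<lambda>y. x * y" "\<lambda>y. y / x"]) (use False in auto)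
  also have "\<dots> = x ^ (CARD('a) - 1) * (\<Prod>y\<in>UNIV - {0}. y)"
    by (simp add: prod.distrib)
  finally have "x ^ (CARD('a) - 1) = 1"
    by simp
  then have "x ^ Suc (CARD('a) - 1) = x"
    by (simp only: power_Suc mult_1_right)
  moreover have "Suc (CARD('a) - 1) = CARD('a)"
    by simp
  ultimately show ?thesis
    by metis
qed simp

lemma add_self_CHAR_2:
  assumes "CHAR('a::ring_1) = 2"
  shows "x + x = (0 :: 'a)"
  using minus_CHAR_2[OF assms, of x x] by simp

lemma add_eq_0_iff_CHAR_2:
  assumes "CHAR('a::ring_1) = 2"
  shows "x + y = 0 \<longleftrightarrow> x = (y :: 'a)"
  using minus_CHAR_2[OF assms, of x y] by (metis right_minus_eq)

lemma add_power_2_CHAR_2: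
  assumes "CHAR('a::comm_ring_1) = 2"
  shows "(x + y :: 'a) ^ 2 ^ k = x ^ 2 ^ k + y ^ 2 ^ k"
  using freshmans_dream'[where ?'a = 'a, of "2 ^ k" k x y] assms by simp

lemma power_2_power_inject_CHAR_2:
  assumes "CHAR('a::idom) = 2"
  shows "(x :: 'a) ^ 2 ^ k = y ^ 2 ^ k \<longleftrightarrow> x = y"
proof
  assume "x ^ 2 ^ k = y ^ 2 ^ k"
  then have "(x + y) ^ 2 ^ k = 0"
    by (simp add: add_power_2_CHAR_2[OF assms] add_self_CHAR_2[OF assms])
  then have "x + y = 0"
    by simp
  then show "x = y"
    by (simp add: add_eq_0_iff_CHAR_2[OF assms])
qed simp

section \<open>Rows of the DDT of a power map\<close>

text \<open>The substitution \<open>x \<mapsto> a * x\<close> takes the factor \<open>a ^ d\<close>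
  out of both powers.\<close>

lemma DDT_power_scale:
  assumes "a \<noteq> 0"
  shows "DDT (\<lambda>x::'a::{field,finite}. x ^ d) a b = DDT (\<lambda>x. x ^ d) 1 (b / a ^ d)"
proof -
  have eq: "(a * x) ^ d + (a * x + a) ^ d = a ^ d * (x ^ d + (x + 1) ^ d)" for x
    by (simp add: distrib_left flip: power_mult_distrib)
  have "bij_betw (\<lambda>x. a * x) {x. x ^ d + (x + 1) ^ d = b / a ^ d} {x. x ^ d + (x + a) ^ d = b}"
    by (rule bij_betw_byWitness[where f' = "\<lambda>x. x / a"])
       (use assms eq eq[of "_ / a"] in \<open>auto simp: field_simps\<close>)
  then show ?thesis
    unfolding DDT_def by (rule bij_betw_same_card[symmetric])
qed

lemma sum_DDT: "(\<Sum>b\<in>UNIV. DDT F a b) = CARD('a)" for F :: "'a::{field,finite} \<Rightarrow> 'a"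
proof -
  have "(\<Sum>b\<in>UNIV. \<Sum>x | x \<in> UNIV \<and> F x + F (x + a) = b. 1) = (\<Sum>x\<in>(UNIV :: 'a set). 1 :: nat)"
    by (rule sum.group) auto
  then show ?thesis
    by (simp add: DDT_def)
qed

lemma DDT_0:
  assumes "CHAR('a::{field,finite}) = 2"
  shows "DDT (F :: 'a \<Rightarrow> 'a) 0 b = (if b = 0 then CARD('a) else 0)"
  by (auto simp: DDT_def add_self_CHAR_2[OF assms])

text \<open>Scaling by \<open>a ^ d\<close> carries row 1 to row \<open>a\<close> for every nonzero
  \<open>a\<close>; row 0 is out of reach of scaling and is counted on its own.\<close>

lemma card_DDT_power_eq:
  fixes k :: nat
  shows "card {(a, b). DDT (\<lambda>x::'a::{field,finite}. x ^ d) a b = k} =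
    card {b. DDT (\<lambda>x::'a. x ^ d) 0 b = k} + (CARD('a) - 1) * card {b. DDT (\<lambda>x::'a. x ^ d) 1 b = k}"
proof -
  let ?D = "DDT (\<lambda>x::'a. x ^ d)"
  have row: "card {b. ?D a b = k} = card {b. ?D 1 b = k}" if "a \<noteq> 0" for a
  proof -
    have "bij_betw (\<lambda>b. a ^ d * b) {b. ?D 1 b = k} {b. ?D a b = k}"
      by (rule bij_betw_byWitness[where f' = "\<lambda>b. b / a ^ d"])
         (use that in \<open>auto simp: DDT_power_scale[OF that]\<close>)
    then show ?thesis
      by (rule bij_betw_same_card[symmetric])
  qed
  have "{(a, b). ?D a b = k} = (SIGMA a:UNIV. {b. ?D a b = k})"
    by auto
  then have "card {(a, b). ?D a b = k} = (\<Sum>a\<in>UNIV. card {b. ?D a b = k})"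
    by simp
  also have "\<dots> = card {b. ?D 0 b = k} + (\<Sum>a\<in>UNIV - {0}. card {b. ?D a b = k})"
    by (rule sum.remove) auto
  also have "\<dots> = card {b. ?D 0 b = k} + (\<Sum>a\<in>UNIV - {0::'a}. card {b. ?D 1 b = k})"
    by (intro arg_cong2[where f = "(+)"] sum.cong row) auto
  also have "\<dots> = card {b. ?D 0 b = k} + (CARD('a) - 1) * card {b. ?D 1 b = k}"
    by (simp only: sum_constant of_nat_id card_Diff_singleton[OF UNIV_I])
  finally show ?thesis .
qed

section \<open>The entries of row 1\<close>

text \<open>Multiplying by \<open>x ^ 2 + x = x * (x + 1)\<close>, which is nonzero here, raises
  both exponents to \<open>2 ^ k\<close>, where powers are additive; the two products
  \<open>x * x ^ 2 ^ k\<close> then cancel.\<close>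

lemma derivative_eq_iff:
  fixes x b :: "'a::field"
  assumes char: "CHAR('a) = 2" and x: "x \<noteq> 0" "x \<noteq> 1"
  shows "x ^ (2 ^ k - 1) + (x + 1) ^ (2 ^ k - 1) = b \<longleftrightarrow> x ^ 2 ^ k + x = b * (x ^ 2 + x)"
proof -
  have mult: "y * y ^ (2 ^ k - 1) = y ^ 2 ^ k" for y :: 'a
    by (simp flip: power_Suc)
  have "(x ^ 2 + x) * (x ^ (2 ^ k - 1) + (x + 1) ^ (2 ^ k - 1)) =
      (x + 1) * (x * x ^ (2 ^ k - 1)) + x * ((x + 1) * (x + 1) ^ (2 ^ k - 1))"
    by (simp add: algebra_simps power2_eq_square)
  also have "\<dots> = (x + 1) * x ^ 2 ^ k + x * (x ^ 2 ^ k + 1)"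
    by (simp only: mult add_power_2_CHAR_2[OF char] power_one)
  also have "\<dots> = x ^ 2 ^ k + x + (x * x ^ 2 ^ k + x * x ^ 2 ^ k)"
    by (simp add: algebra_simps)
  finally have eq: "(x ^ 2 + x) * (x ^ (2 ^ k - 1) + (x + 1) ^ (2 ^ k - 1)) = x ^ 2 ^ k + x"
    by (simp add: add_self_CHAR_2[OF char])
  have "x ^ 2 + x = x * (x + 1)"
    by (simp add: algebra_simps power2_eq_square)
  then have "x ^ 2 + x \<noteq> 0"
    using x by (simp add: add_eq_0_iff_CHAR_2[OF char])
  then show ?thesis
    using eq by (metis mult.commute mult_left_cancel)
qed

lemma card_linearized_roots_le_4:
  fixes b :: "'a::{field,finite}"
  assumes card: "CARD('a) = 2 ^ n" and k: "2 * k = n + e" and e: "e \<in> {1, 2}" and "b \<noteq> 1"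
  shows "card {x :: 'a. x ^ 2 ^ k + x = b * (x ^ 2 + x)} \<le> 4"
proof -
  note char = CHAR_eq_2_of_CARD[OF card]
  note add0 = add_eq_0_iff_CHAR_2[OF char]
  define B where "B = b ^ 2 ^ k"
  \<comment> \<open>The first summand is what becomes of \<open>x ^ 2 ^ (2 * k)\<close> when
    \<open>x ^ 2 ^ k = b * x ^ 2 + (b + 1) * x\<close> is used twice; the monomial is the same power
    reduced by the field order. As \<open>2 ^ e\<close> is 2 or 4, the monomial leaves the linear
    coefficient alone and keeps the degree at most 4.\<close>
  define p where "p = [:0, (B + 1) * (b + 1), B * b ^ 2 + B + B * b + b, 0, B * b ^ 2:] - monom 1 (2 ^ e)"
  have "B \<noteq> 1"
    using power_2_power_inject_CHAR_2[OF char, of b k 1] \<open>b \<noteq> 1\<close> by (simp add: B_def)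
  then have "coeff p 1 \<noteq> 0"
    using \<open>b \<noteq> 1\<close> e by (auto simp: p_def add0)
  then have "p \<noteq> 0"
    by auto
  have "degree p \<le> 4"
    unfolding p_def using e
    by (intro degree_diff_le) (auto intro: order.trans[OF degree_monom_le])
  have "poly p x = 0" if "x ^ 2 ^ k + x = b * (x ^ 2 + x)" for x
  proof -
    have sq: "(y + z) ^ 2 = y ^ 2 + z ^ 2" for y z :: 'a
      using add_power_2_CHAR_2[OF char, of y z 1] by simp
    have "x ^ 2 ^ k = x ^ 2 ^ k + (x + x)"
      by (simp add: add_self_CHAR_2[OF char])
    also have "\<dots> = b * (x ^ 2 + x) + x"
      using that by (metis add.assoc)
    finally have xk: "x ^ 2 ^ k = b * x ^ 2 + (b + 1) * x"
      by (simp add: algebra_simps)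
    have "x ^ 2 ^ e = (x ^ 2 ^ n) ^ 2 ^ e"
      using power_CARD_eq_same[of x] card by simp
    also have "\<dots> = (x ^ 2 ^ k) ^ 2 ^ k"
      by (simp flip: power_mult power_add k mult_2)
    also have "\<dots> = B * (x ^ 2 ^ k) ^ 2 + (B + 1) * x ^ 2 ^ k"
      by (subst xk) (simp add: add_power_2_CHAR_2[OF char] power_mult_distrib B_def power_commutes mult.commute
        flip: power_mult)
    also have "\<dots> = B * (b ^ 2 * x ^ 4 + (b ^ 2 + 1) * x ^ 2) + (B + 1) * (b * x ^ 2 + (b + 1) * x)"
      by (simp add: xk sq power_mult_distrib flip: power_mult)
    also have "\<dots> = poly (p + monom 1 (2 ^ e)) x + (B * b * (b * x ^ 2 - b * x ^ 2))"
      by (simp add: p_def algebra_simps power2_eq_square power4_eq_xxxx)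
    finally show ?thesis
      by (simp add: poly_monom)
  qed
  then have "card {x :: 'a. x ^ 2 ^ k + x = b * (x ^ 2 + x)} \<le> card {x. poly p x = 0}"
    by (intro card_mono) auto
  also have "\<dots> \<le> degree p"
    by (rule card_poly_roots_bound) fact
  finally show ?thesis
    using \<open>degree p \<le> 4\<close> by simp
qed

lemma DDT_neq_1:
  fixes b :: "'a::{field,finite}"
  assumes card: "CARD('a) = 2 ^ n" and k: "2 * k = n + e" and e: "e \<in> {1, 2}"
    and "k \<ge> 1" and "b \<noteq> 1"
  shows "DDT (\<lambda>x. x ^ (2 ^ k - 1)) 1 b \<in> {0, 2}"
proof -
  note char = CHAR_eq_2_of_CARD[OF card]
  define S where "S = {x :: 'a. x ^ (2 ^ k - 1) + (x + 1) ^ (2 ^ k - 1) = b}"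
  define K where "K = {x :: 'a. x ^ 2 ^ k + x = b * (x ^ 2 + x)}"
  have "(2::nat) ^ k \<ge> 2 ^ 1"
    using \<open>k \<ge> 1\<close> by (intro power_increasing) auto
  then have pos: "2 ^ k - 1 > (0::nat)"
    by simp
  have S01: "x \<noteq> 0 \<and> x \<noteq> 1" if "x \<in> S" for x
    using that pos \<open>b \<noteq> 1\<close> by (auto simp: S_def add_self_CHAR_2[OF char] power_0_left)
  \<comment> \<open>At 0 and 1 the sum of powers is 1, so neither lies in \<open>S\<close>, yet both
    solve the additive equation. This lowers the bound from 4 to 2.\<close>
  have "S \<subseteq> K - {0, 1}"
    using S01 derivative_eq_iff[OF char] by (auto simp: S_def K_def)
  then have "card S \<le> card (K - {0, 1})"
    by (intro card_mono) auto
  also have "{0, 1} \<subseteq> K"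
    by (auto simp: K_def add_self_CHAR_2[OF char] power_0_left)
  then have "card (K - {0, 1}) = card K - 2"
    by (subst card_Diff_subset) auto
  also have "\<dots> \<le> 2"
    using card_linearized_roots_le_4[OF card k e \<open>b \<noteq> 1\<close>] by (simp add: K_def)
  finally have le: "card S \<le> 2" .
  show ?thesis
  proof (cases "S = {}")
    case True
    then show ?thesis
      by (simp add: S_def DDT_def)
  next
    case False
    then obtain x where x: "x \<in> S"
      by auto
    \<comment> \<open>Solutions come in pairs \<open>x\<close>, \<open>x + 1\<close>, so a nonempty
      \<open>S\<close> has at least two elements.\<close>
    then have "x + 1 \<in> S"
      by (simp only: S_def mem_Collect_eq add.assoc[of x 1 1] add_self_CHAR_2[OF char] add_0_right add.commute[of "(x + 1) ^ _"])
    with x have "card {x, x + 1} \<le> card S"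
      by (intro card_mono) auto
    with le have "card S = 2"
      by simp
    then show ?thesis
      by (simp add: S_def DDT_def)
  qed
qed

text \<open>For \<open>b = 1\<close> the additive equation becomes
  \<open>x ^ 2 ^ (m + 1) = x ^ 2\<close>, and squaring is injective. The points 0 and 1 satisfy both
  conditions and are checked directly.\<close>

lemma DDT_1_1:
  assumes char: "CHAR('a::{field,finite}) = 2" and "m \<ge> 1"
  shows "DDT (\<lambda>x::'a. x ^ (2 ^ (m + 1) - 1)) 1 1 = card {x :: 'a. x ^ 2 ^ m = x}"
proof -
  have pos: "2 ^ (m + 1) - 1 > (0::nat)"
    using one_less_power[of "2::nat" "m + 1"] by (simp del: power_Suc)
  have "x ^ (2 ^ (m + 1) - 1) + (x + 1) ^ (2 ^ (m + 1) - 1) = 1 \<longleftrightarrow> x ^ 2 ^ m = x" for x :: 'a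
  proof (cases "x = 0 \<or> x = 1")
    case True
    then show ?thesis
      using pos by (auto simp: add_self_CHAR_2[OF char] power_0_left)
  next
    case False
    then have "x ^ (2 ^ (m + 1) - 1) + (x + 1) ^ (2 ^ (m + 1) - 1) = 1 \<longleftrightarrow>
        x ^ 2 ^ (m + 1) = x ^ 2"
      using derivative_eq_iff[OF char, of x "m + 1" 1] by simp
    also have "x ^ 2 ^ (m + 1) = (x ^ 2 ^ m) ^ 2"
      by (simp add: mult.commute flip: power_mult)
    also have "\<dots> = x ^ 2 \<longleftrightarrow> x ^ 2 ^ m = x"
      using power_2_power_inject_CHAR_2[OF char, of _ 1] by simp
    finally show ?thesis .
  qed
  then show ?thesis
    by (simp add: DDT_def)
qed

section \<open>Fixed points of \<open>x \<mapsto> x ^ 2 ^ m\<close>\<close>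

text \<open>Raising to the field order applies the map \<open>x \<mapsto> x ^ 2 ^ m\<close> twice
  and then squares, so a fixed point satisfies \<open>x = x ^ 2\<close>.\<close>

lemma card_fixed_points_odd:
  assumes card: "CARD('a::{field,finite}) = 2 ^ (2 * m + 1)"
  shows "card {x :: 'a. x ^ 2 ^ m = x} = 2"
proof -
  have "x = 0 \<or> x = 1" if x: "x ^ 2 ^ m = x" for x :: 'a
  proof -
    have "x = x ^ 2 ^ (2 * m + 1)"
      using power_CARD_eq_same[of x] card by simp
    also have "\<dots> = ((x ^ 2 ^ m) ^ 2 ^ m) ^ 2"
      by (simp add: mult.commute mult_2_right power_add flip: power_mult)
    finally have "x * (x - 1) = 0"
      by (simp add: x algebra_simps power2_eq_square)
    then show ?thesis
      by simp
  qed
  then have "{x :: 'a. x ^ 2 ^ m = x} = {0, 1}"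
    by (auto simp: power_0_left)
  then show ?thesis
    by simp
qed

text \<open>The map \<open>x \<mapsto> x ^ 2 ^ m + x\<close> is additive and squares to zero, so its image lies in its kernel,
  while each fibre has at most \<open>2 ^ m\<close> elements.\<close>

lemma card_fixed_points_even:
  assumes card: "CARD('a::{field,finite}) = 2 ^ (2 * m)" and "m \<ge> 1"
  shows "card {x :: 'a. x ^ 2 ^ m = x} = 2 ^ m"
proof -
  note char = CHAR_eq_2_of_CARD[OF card]
  define f where "f = (\<lambda>x :: 'a. x ^ 2 ^ m + x)"
  have fixed: "x ^ 2 ^ m = x \<longleftrightarrow> f x = 0" for x
    by (simp add: f_def add_eq_0_iff_CHAR_2[OF char])
  have fibre: "card {x. f x = c} \<le> 2 ^ m" for c
  proof -
    define p where "p = monom 1 (2 ^ m) + [:- c, 1:]"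
    \<comment> \<open>For \<open>m = 0\<close> the monomial would be linear and could cancel against
      \<open>[:- c, 1:]\<close>.\<close>
    have m: "(2::nat) ^ m \<ge> 2 ^ 1"
      using \<open>m \<ge> 1\<close> by (intro power_increasing) auto
    have "degree p = 2 ^ m"
      unfolding p_def using m by (subst degree_add_eq_left) (auto simp: degree_monom_eq)
    moreover from this have "p \<noteq> 0"
      by auto
    moreover have "{x. f x = c} = {x. poly p x = 0}"
      by (auto simp: p_def f_def poly_monom algebra_simps)
    ultimately show ?thesis
      using card_poly_roots_bound[of p] by simp
  qed
  have "f (f x) = 0" for x
  proof -
    have "(x ^ 2 ^ m) ^ 2 ^ m = x"
      using power_CARD_eq_same[of x] card by (simp add: mult_2 power_add flip: power_mult)
    then show ?thesis
      by (simp add: f_def add_power_2_CHAR_2[OF char] add.commute add_self_CHAR_2[OF char])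
  qed
  then have "card (range f) \<le> card {x. f x = 0}"
    by (intro card_mono) auto
  \<comment> \<open>The fibres over the image partition the field, so the image, and with it the
    kernel, has at least \<open>2 ^ m\<close> elements.\<close>
  have "2 ^ m * 2 ^ m = CARD('a)"
    by (simp add: card mult_2 power_add)
  also have "\<dots> = (\<Sum>c\<in>range f. card {x. f x = c})"
    using sum.image_gen[of "UNIV :: 'a set" "\<lambda>_. 1 :: nat" f] by simp
  also have "\<dots> \<le> card (range f) * 2 ^ m"
    using sum_bounded_above[of "range f" "\<lambda>c. card {x. f x = c}" "2 ^ m"] fibre by simp
  finally have "2 ^ m \<le> card (range f)"
    by simp
  with \<open>card (range f) \<le> card {x. f x = 0}\<close> fibre[of 0] show ?thesis
    by (simp add: fixed)
qed

section \<open>Value counts in row 1 and in the whole table\<close>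

text \<open>The last two claims are linear equations for the numbers of twos and zeros away from
  \<open>b = 1\<close>: one sums the entries of the row, the other counts its positions.\<close>

lemma card_row_1:
  assumes "m \<ge> 1" and n: "n = 2 * m \<or> n = 2 * m + 1" and card: "CARD('a::{field,finite}) = 2 ^ n"
  defines "D \<equiv> DDT (\<lambda>x::'a. x ^ (2 ^ (m + 1) - 1)) 1"
  shows "D 1 = (if n = 2 * m then 2 ^ m else 2)"
    and "\<And>b. b \<noteq> 1 \<Longrightarrow> D b \<in> {0, 2}"
    and "2 * card {b. b \<noteq> 1 \<and> D b = 2} + D 1 = 2 ^ n"
    and "card {b. b \<noteq> 1 \<and> D b = 2} + card {b. b \<noteq> 1 \<and> D b = 0} + 1 = 2 ^ n"
proof -
  note char = CHAR_eq_2_of_CARD[OF card]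
  show "D 1 = (if n = 2 * m then 2 ^ m else 2)"
    using DDT_1_1[OF char \<open>m \<ge> 1\<close>] card_fixed_points_odd[where 'a = 'a, of m] card_fixed_points_even[where 'a = 'a, of m]
      n card \<open>m \<ge> 1\<close> by (auto simp: D_def)
  show D: "D b \<in> {0, 2}" if "b \<noteq> 1" for b
    unfolding D_def
    \<comment> \<open>With \<open>k = m + 1\<close>, the excess \<open>e = 2 * k - n\<close> is 2
      for \<open>n = 2 * m\<close> and 1 for \<open>n = 2 * m + 1\<close>.\<close>
    by (rule DDT_neq_1[OF card, of _ "2 * m + 2 - n"]) (use n that in auto)
  let ?T = "{b. b \<noteq> 1 \<and> D b = 2}" and ?Z = "{b. b \<noteq> 1 \<and> D b = 0}"
  have "b \<in> insert 1 (?T \<union> ?Z)" for b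
    using D[of b] by auto
  then have split: "UNIV = insert 1 (?T \<union> ?Z)"
    by blast
  have "2 ^ n = (\<Sum>b\<in>UNIV. D b)"
    unfolding D_def sum_DDT card ..
  also have "\<dots> = D 1 + (\<Sum>b\<in>?T. D b) + (\<Sum>b\<in>?Z. D b)"
    by (subst split, subst sum.insert, simp, simp, subst sum.union_disjoint) auto
  finally show "2 * card ?T + D 1 = 2 ^ n"
    by simp
  have "2 ^ n = card (insert 1 (?T \<union> ?Z))"
    using split card by simp
  also have "\<dots> = Suc (card ?T + card ?Z)"
    by (subst card_insert_disjoint, simp, simp, subst card_Un_disjoint) auto
  finally show "card ?T + card ?Z + 1 = 2 ^ n"
    by simp
qed

(* For n = 2m with m = 1 the values 2^m and 2 coincide, so the two corresponding counts
   are merged into their sum. *)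
theorem proposition1:
  fixes m n :: nat
    and F :: "'a::{field,finite} \<Rightarrow> 'a"
  assumes "m \<ge> 1"
    and "n = 2 * m \<or> n = 2 * m + 1"
    and "CARD('a) = 2 ^ n"
    and "F = (\<lambda>x. x ^ (2 ^ (m + 1) - 1))"
  shows "card {(a, b). DDT F a b = 2 ^ n} = 1 \<and>
         (n = 2 * m + 1 \<longrightarrow>
           card {(a, b). DDT F a b = 2} = 2 ^ (n - 1) * (2 ^ n - 1) \<and>
           card {(a, b). DDT F a b = 0} = 2 ^ (2 * n - 1) + 2 ^ (n - 1) - 1) \<and>
         (n = 2 * m \<longrightarrow>
           (m \<ge> 2 \<longrightarrow>
              card {(a, b). DDT F a b = 2 ^ m} = 2 ^ n - 1 \<and>
              card {(a, b). DDT F a b = 2} = (2 ^ (n - 1) - 2 ^ (m - 1)) * (2 ^ n - 1)) \<and>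
           (m = 1 \<longrightarrow>
              card {(a, b). DDT F a b = 2} =
                (2 ^ n - 1) + (2 ^ (n - 1) - 2 ^ (m - 1)) * (2 ^ n - 1)) \<and>
           card {(a, b). DDT F a b = 0} = (2 ^ (n - 1) + 2 ^ (m - 1)) * (2 ^ n - 1))"
proof -
  note char = CHAR_eq_2_of_CARD[OF assms(3)]
  define D where "D = DDT (\<lambda>x::'a. x ^ (2 ^ (m + 1) - 1)) 1"
  define T where "T = card {b. b \<noteq> 1 \<and> D b = 2}"
  define Z where "Z = card {b. b \<noteq> 1 \<and> D b = 0}"
  note row = card_row_1[OF assms(1-3), folded D_def, folded T_def Z_def]
  \<comment> \<open>The first summand is row 0, whose only nonzero entry is \<open>2 ^ n\<close> at
    \<open>b = 0\<close>.\<close>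
  have count: "card {(a, b). DDT F a b = k} = card {b :: 'a. (if b = 0 then 2 ^ n else 0) = k}
      + (2 ^ n - 1) * card {b. D b = k}" for k
    using card_DDT_power_eq[where 'a = 'a, of "2 ^ (m + 1) - 1" k]
    by (simp add: assms(3,4) D_def DDT_0[OF char])
  have "n \<ge> 2"
    using assms(1,2) by auto
  then have n4: "(2::nat) ^ n \<ge> 2 ^ 2"
    by (intro power_increasing) auto
  have D1: "D 1 < 2 ^ n" "D 1 > 0"
  proof -
    have "n > m"
      using assms(1,2) by auto
    then have "(2::nat) ^ m < 2 ^ n"
      by simp
    then show "D 1 < 2 ^ n" "D 1 > 0"
      using n4 row(1) by auto
  qed
  have "D b \<noteq> 2 ^ n" for b
    using D1 row(2)[of b] n4 by (cases "b = 1") auto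
  then have "{b. D b = 2 ^ n} = {}"
    by simp
  moreover have "{b :: 'a. (if b = 0 then 2 ^ n else 0) = (2 ^ n :: nat)} = {0}"
    by auto
  ultimately have full: "card {(a, b). DDT F a b = 2 ^ n} = 1"
    by (simp add: count)
  have row_0: "{b :: 'a. (if b = 0 then 2 ^ n else 0) = k} = {}" if "k \<noteq> 0" "k \<noteq> 2 ^ n" for k :: nat
    using that by auto
  have "{b :: 'a. (if b = 0 then 2 ^ n else 0) = (0 :: nat)} = UNIV - {0}"
    by auto
  then have "card {b :: 'a. (if b = 0 then 2 ^ n else 0) = (0 :: nat)} = 2 ^ n - 1"
    by (simp add: assms(3) card_Diff_singleton)
  moreover have "{b. D b = 0} = {b. b \<noteq> 1 \<and> D b = 0}"
    using D1 by auto
  ultimately have zeros: "card {(a, b). DDT F a b = 0} = (2 ^ n - 1) * (Z + 1)"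
    by (simp add: count Z_def)
  \<comment> \<open>The entry at \<open>b = 1\<close> is itself 2 when \<open>n\<close> is odd or
    \<open>m = 1\<close>, hence the correction to \<open>T\<close>.\<close>
  have twos: "card {(a, b). DDT F a b = 2} = (2 ^ n - 1) * (T + (if D 1 = 2 then 1 else 0))"
  proof -
    have "{b. D b = 2} = {b. b \<noteq> 1 \<and> D b = 2} \<union> (if D 1 = 2 then {1} else {})"
      by auto
    then have "card {b. D b = 2} = T + (if D 1 = 2 then 1 else 0)"
      by (auto simp: T_def)
    then show ?thesis
      using n4 by (simp add: count row_0)
  qed
  define N :: nat where "N = 2 ^ (n - 1)"
  have N: "2 ^ n = 2 * N"
    using \<open>n \<ge> 2\<close> by (simp add: N_def flip: power_Suc)
  have odd: "card {(a, b). DDT F a b = 2} = 2 ^ (n - 1) * (2 ^ n - 1)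
      \<and> card {(a, b). DDT F a b = 0} = 2 ^ (2 * n - 1) + 2 ^ (n - 1) - 1" if "n = 2 * m + 1"
  proof -
    have D2: "D 1 = 2"
      using row(1) that by simp
    then have T: "T + 1 = N" and Z: "Z = N"
      using row(3,4) N by auto
    have "(2::nat) ^ (2 * n - 1) = 2 ^ (n + (n - 1))"
      using \<open>n \<ge> 2\<close> by (intro arg_cong[where f = "\<lambda>i. 2 ^ i"]) auto
    also have "\<dots> = 2 * N * N"
      by (simp add: power_add N N_def)
    finally have "2 ^ (2 * n - 1) + 2 ^ (n - 1) - 1 = 2 * N * N + N - 1"
      by (simp add: N_def)
    \<comment> \<open>Subtraction is truncated on \<open>nat\<close>; since \<open>N\<close> is
      positive, splitting off a successor turns it into ordinary arithmetic.\<close>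
    also have "\<dots> = (2 * N - 1) * (N + 1)"
      using n4 N by (cases N) (auto simp: algebra_simps)
    finally show ?thesis
      by (simp only: twos zeros T Z D2 N if_True mult.commute N_def[symmetric] simp_thms)
  qed
  have even: "T = 2 ^ (n - 1) - 2 ^ (m - 1) \<and> Z + 1 = 2 ^ (n - 1) + 2 ^ (m - 1)" if "n = 2 * m"
  proof -
    have "(2::nat) ^ m = 2 * 2 ^ (m - 1)"
      using \<open>m \<ge> 1\<close> by (simp flip: power_Suc)
    then show ?thesis
      unfolding N_def[symmetric] using row(1,3,4) that N D1 by auto
  qed
  have special: "card {(a, b). DDT F a b = 2 ^ m} = 2 ^ n - 1" if "n = 2 * m" "m \<ge> 2"
  proof -
    have "(2::nat) ^ m \<ge> 2 ^ 2"
      using that by (intro power_increasing) auto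
    moreover have D1m: "D 1 = 2 ^ m"
      using row(1) that by simp
    \<comment> \<open>Since \<open>2 ^ m \<ge> 4\<close>, this value differs from the 0 and 2 found
      at all other positions.\<close>
    ultimately have "D b = 2 ^ m \<longleftrightarrow> b = 1" for b
      using row(2)[of b] by (cases "b = 1") auto
    then have "{b. D b = 2 ^ m} = {1}"
      by simp
    then show ?thesis
      using D1 D1m by (simp add: count row_0)
  qed
  have D1_eq: "D 1 = 2 \<longleftrightarrow> m = 1" if "n = 2 * m"
  proof -
    have "(2::nat) ^ m = 2 ^ 1 \<longleftrightarrow> m = 1"
      by (rule power_inject_exp) simp
    then show ?thesis
      using row(1) that by simp
  qed
  show ?thesis
  proof (intro conjI impI)
    assume n: "n = 2 * m"
    show "card {(a, b). DDT F a b = 0} = (2 ^ (n - 1) + 2 ^ (m - 1)) * (2 ^ n - 1)"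
      using zeros even[OF n] by (metis mult.commute)
    show "card {(a, b). DDT F a b = 2} = (2 ^ (n - 1) - 2 ^ (m - 1)) * (2 ^ n - 1)" if "m \<ge> 2"
      using twos even[OF n] D1_eq[OF n] that by (simp add: mult.commute)
    show "card {(a, b). DDT F a b = 2} = (2 ^ n - 1) + (2 ^ (n - 1) - 2 ^ (m - 1)) * (2 ^ n - 1)"
      if "m = 1"
    proof -
      have "card {(a, b). DDT F a b = 2} = (2 ^ n - 1) * (T + 1)"
        using twos D1_eq[OF n] that by simp
      also have "\<dots> = (2 ^ n - 1) + T * (2 ^ n - 1)"
        by (simp add: mult.commute)
      finally show ?thesis
        using even[OF n] by simp
    qed
  qed (use full odd special in blast)+
qed

end
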